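(* Let $T\in\mathbb Z_{\ge0}$, $N\in\mathbb Z_{\ge1}$, and let $G=(V,E)$ be a finite directed acyclic planar graph with $V=V_0\sqcup V_1\sqcup\dots\sqcup V_T$ and $E=E_{0\to1}\sqcup\dots\sqcup E_{T-1\to T}$, where $E_{n\to n+1}$ contains only edges directed from a vertex of $V_n$ to a vertex of $V_{n+1}$. Let $w_e\in\mathbb R$, $e\in E$, be edge weights, and let $\psi_i:V_0\to\mathbb R$ and $\varphi_i:V_T\to\mathbb R$, $1\le i\le N$, be functions. With $\mathcal W(x,y)=\sum_{\pi:x\to y}w(\pi)$ for $x\in V_0$, $y\in V_T$, set $\varphi_j^{(0)}(x)=\sum_{y\in V_T}\mathcal W(x,y)\varphi_j(y)$ for $x\in V_0$, and assume the biorthogonality condition $$\sum_{x\in V_0}\psi_i(x)\varphi_j^{(0)}(x)=\mathbf 1_{i=j},\qquad 1\le i,j\le N .$$ Let $\nu(\Pi)=Wt(\Pi)/Z$ be the (signed, total mass one) measure on $\mathcal{N.I.}(N)$ defined in the context, where $Z\ne0$. Let $f_n:E_{n\to n+1}\to\mathbb R$, $0\le n\le T-1$, be arbitrary functions; for a path $\pi$ from $V_0$ to $V_T$ with successive edges $e_0,\dots,e_{T-1}$ put $f(\pi)=\prod_{n=0}^{T-1}f_n(e_n)$. Let $\tilde w_e=f_n(e)w_e$ for $e\in E_{n\to n+1}$, and $\widetilde{\mathcal W}(x,y)=\sum_{\pi:x\to y}\tilde w(\pi)$ for $x\in V_0,\ y\in V_T$. Then $$\sum_{\Pi=\{\pi_1,\dots,\pi_N\}\in\mathcal{N.I.}(N)}\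 \prod_{i=1}^N f(\pi_i)\,\nu(\Pi)=\det\big(I-K+\widetilde{\mathcal W}\mathcal W^{-1}K\big)_{L^2(V_0)},$$ where $K:L^2(V_0)\to L^2(V_0)$ has kernel $K(x_1,x_2)=\sum_{i=1}^N\varphi_i^{(0)}(x_1)\psi_i(x_2)$, and $\mathcal W^{-1}$ is the right inverse of $\mathcal W$ on $\mathrm{span}\{\varphi^{(0)}_i\}_{i=1}^N$ given by $\mathcal W^{-1}\varphi_j^{(0)}=\varphi_j$, so that $\mathcal W^{-1}K:L^2(V_0)\to L^2(V_T)$ has kernel $\sum_{i=1}^N\varphi_i(y)\psi_i(x)$.
   Context: A path $\pi$ from $V_0$ to $V_T$ is a sequence of edges $(x_0\to x_1,\ x_1\to x_2,\dots,x_{T-1}\to x_T)$ with $x_n\in V_n$; write $\pi(n)=x_n$. Its weight $w(\pi)$ is the product of the weights of its edges (similarly $\tilde w(\pi)$), and $\sum_{\pi:x\to y}$ is over all paths from $x$ to $y$. Two paths intersect if they share a vertex. $\mathcal{N.I.}(N)$ is the set of all (unordered) collections $\Pi=\{\pi_1,\dots,\pi_N\}$ of $N$ paths from $V_0$ to $V_T$ no two of which intersect. For $\Pi\in\mathcal{N.I.}(N)$, $$Wt(\Pi)=\det[\psi_i(\pi_j(0))]_{i,j=1}^N\Big(\prod_{i=1}^Nw(\pi_i)\Big)\det[\varphi_i(\pi_j(T))]_{i,j=1}^N,$$ which does not depend on the labelling of the paths, and $Z=\sum_{\Pi\in\mathcal{N.I.}(N)}Wt(\Pi)$. $L^2$ of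 a finite set is with respect to counting measure, so operators are matrices and determinants are ordinary determinants; $\widetilde{\mathcal W}$ maps $L^2(V_T)$ to $L^2(V_0)$ by $\widetilde{\mathcal W}g(x)=\sum_{y}\widetilde{\mathcal W}(x,y)g(y)$. *)

theory Defs
  imports "HOL-Analysis.Analysis" "Graph_Theory.Pair_Digraph"
begin

subsection \<open>Layered planar graphs and their paths\<close>

text \<open>
  Planarity is the existence of a drawing: distinct vertices are sent to distinct points, each arc
  to a simple curve between the images of its endpoints, a curve meets the vertex set only in its
  endpoints, and two different curves meet only in vertices. (Simple rather than injective curves, so
  that the definition is also correct for graphs with loops.)
\<close>

definition plane_drawing ::
    "'v pair_pre_digraph \<Rightarrow> ('v \<Rightarrow> complex) \<Rightarrow> ('v \<times> 'v \<Rightarrow> real \<Rightarrow> complex) \<Rightarrow> bool" where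
  "plane_drawing G pt \<gamma> \<longleftrightarrow>
     inj_on pt (pverts G) \<and>
     (\<forall>e\<in>parcs G. simple_path (\<gamma> e) \<and>
        pathstart (\<gamma> e) = pt (fst e) \<and> pathfinish (\<gamma> e) = pt (snd e) \<and>
        path_image (\<gamma> e) \<inter> pt ` pverts G \<subseteq> {pt (fst e), pt (snd e)}) \<and>
     (\<forall>e\<in>parcs G. \<forall>e'\<in>parcs G. e \<noteq> e' \<longrightarrow>
        path_image (\<gamma> e) \<inter> path_image (\<gamma> e') \<subseteq> pt ` pverts G)"

definition planar_digraph :: "'v pair_pre_digraph \<Rightarrow> bool" where
  "planar_digraph G \<longleftrightarrow> (\<exists>pt \<gamma>. plane_drawing G pt \<gamma>)"

text \<open>The arcs from the \<open>n\<close>-th layer to the next one.\<close>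

definition layer_arcs :: "'v pair_pre_digraph \<Rightarrow> (nat \<Rightarrow> 'v set) \<Rightarrow> nat \<Rightarrow> ('v \<times> 'v) set" where
  "layer_arcs G V n = parcs G \<inter> V n \<times> V (Suc n)"

locale layered_planar_digraph = pair_fin_digraph G for G :: "'v pair_pre_digraph" +
  fixes T :: nat and V :: "nat \<Rightarrow> 'v set"
  assumes acyclic_arcs: "acyclic (parcs G)"
    and planar: "planar_digraph G"
    and verts_layers: "pverts G = (\<Union>n\<le>T. V n)"
    and disjoint_layers: "disjoint_family_on V {..T}"
    and arcs_layers: "parcs G = (\<Union>n<T. layer_arcs G V n)"

text \<open>
  Arcs being pairs of vertices, a path is given by the list of its vertices, \<open>p ! n\<close> being the one in
  the \<open>n\<close>-th layer. For \<open>T = 0\<close> the paths are the one-vertex lists.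
\<close>

definition layered_paths :: "'v pair_pre_digraph \<Rightarrow> nat \<Rightarrow> (nat \<Rightarrow> 'v set) \<Rightarrow> 'v list set" where
  "layered_paths G T V =
     {p. length p = Suc T \<and> (\<forall>n\<le>T. p ! n \<in> V n) \<and> (\<forall>n<T. (p ! n, p ! Suc n) \<in> parcs G)}"

definition path_weight :: "nat \<Rightarrow> ('v \<times> 'v \<Rightarrow> real) \<Rightarrow> 'v list \<Rightarrow> real" where
  "path_weight T w p = (\<Prod>n<T. w (p ! n, p ! Suc n))"

text \<open>The kernel \<open>\<W>(x,y)\<close>.\<close>

definition path_kernel ::
    "'v pair_pre_digraph \<Rightarrow> nat \<Rightarrow> (nat \<Rightarrow> 'v set) \<Rightarrow> ('v \<times> 'v \<Rightarrow> real) \<Rightarrow> 'v \<Rightarrow> 'v \<Rightarrow> real" where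
  "path_kernel G T V w x y =
     (\<Sum>p | p \<in> layered_paths G T V \<and> p ! 0 = x \<and> p ! T = y. path_weight T w p)"

definition nonintersecting ::
    "'v pair_pre_digraph \<Rightarrow> nat \<Rightarrow> (nat \<Rightarrow> 'v set) \<Rightarrow> nat \<Rightarrow> 'v list set set" where
  "nonintersecting G T V N =
     {\<P>. \<P> \<subseteq> layered_paths G T V \<and> finite \<P> \<and> card \<P> = N \<and>
          pairwise (\<lambda>p q. set p \<inter> set q = {}) \<P>}"

subsection \<open>Determinants over a finite index set\<close>

text \<open>
  Leibniz formula for the matrix of \<open>M\<close> with rows and columns indexed by the finite set \<open>S\<close>; used for
  \<open>S = {1..N}\<close> and for operators on \<open>L\<^sup>2(S)\<close>.
\<close>

definition det_on :: "'i set \<Rightarrow> ('i \<Rightarrow> 'i \<Rightarrow> real) \<Rightarrow> real" where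
  "det_on S M = (\<Sum>p | p permutes S. of_int (sign p) * (\<Prod>i\<in>S. M i (p i)))"

lemma det_on_UNIV: "det_on UNIV (\<lambda>i j. A $ i $ j) = det A"
  by (simp add: det_on_def det_def)

lemma det_on_cong:
  assumes "\<And>i j. i \<in> S \<Longrightarrow> j \<in> S \<Longrightarrow> M i j = M' i j"
  shows "det_on S M = det_on S M'"
  unfolding det_on_def
  by (intro sum.cong refl arg_cong2[where f = "(*)"] prod.cong)
     (auto simp: assms permutes_in_image)

lemma det_on_permute_columns:
  assumes s: "s permutes S" and fin: "finite S"
  shows "det_on S (\<lambda>i j. M i (s j)) = of_int (sign s) * det_on S M"
proof -
  have "det_on S M
        = (\<Sum>p | p permutes S. of_int (sign (s \<circ> p)) * (\<Prod>i\<in>S. M i ((s \<circ> p) i)))"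
    unfolding det_on_def by (rule setum_permutations_compose_left[OF s])
  also have "\<dots> = (\<Sum>p | p permutes S. of_int (sign s) * (of_int (sign p) * (\<Prod>i\<in>S. M i (s (p i)))))"
  proof (rule sum.cong)
    fix p assume "p \<in> {p. p permutes S}"
    then have "sign (s \<circ> p) = sign s * sign p"
      using sign_compose permutes_imp_permutation[OF fin] s by blast
    then show "of_int (sign (s \<circ> p)) * (\<Prod>i\<in>S. M i ((s \<circ> p) i))
        = of_int (sign s) * (of_int (sign p) * (\<Prod>i\<in>S. M i (s (p i))))"
      by simp
  qed simp
  also have "\<dots> = of_int (sign s) * det_on S (\<lambda>i j. M i (s j))"
    by (simp add: det_on_def sum_distrib_left)
  finally show ?thesis
    by (simp add: mult.assoc[symmetric] flip: of_int_mult)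
qed

subsection \<open>The signed measure on non-intersecting path collections\<close>

text \<open>The weight of a family of paths labelled by \<open>1, \<dots>, N\<close>.\<close>

definition labelled_Wt ::
    "nat \<Rightarrow> nat \<Rightarrow> ('v \<times> 'v \<Rightarrow> real) \<Rightarrow> (nat \<Rightarrow> 'v \<Rightarrow> real) \<Rightarrow> (nat \<Rightarrow> 'v \<Rightarrow> real)
      \<Rightarrow> (nat \<Rightarrow> 'v list) \<Rightarrow> real" where
  "labelled_Wt T N w \<psi> \<phi> \<pi> =
     det_on {1..N} (\<lambda>i j. \<psi> i (\<pi> j ! 0)) * (\<Prod>i=1..N. path_weight T w (\<pi> i)) *
     det_on {1..N} (\<lambda>i j. \<phi> i (\<pi> j ! T))"

text \<open>The choice of the labelling is immaterial, see \<open>Wt_eq_labelled_Wt\<close> below.\<close>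

definition Wt ::
    "nat \<Rightarrow> nat \<Rightarrow> ('v \<times> 'v \<Rightarrow> real) \<Rightarrow> (nat \<Rightarrow> 'v \<Rightarrow> real) \<Rightarrow> (nat \<Rightarrow> 'v \<Rightarrow> real)
      \<Rightarrow> 'v list set \<Rightarrow> real" where
  "Wt T N w \<psi> \<phi> \<P> = labelled_Wt T N w \<psi> \<phi> (SOME \<pi>. bij_betw \<pi> {1..N} \<P>)"

lemma labelled_Wt_indep:
  assumes "bij_betw \<pi> {1..N} \<P>" "bij_betw \<pi>' {1..N} \<P>"
  shows "labelled_Wt T N w \<psi> \<phi> \<pi> = labelled_Wt T N w \<psi> \<phi> \<pi>'"
proof -
  define s where "s = (\<lambda>j. if j \<in> {1..N} then inv_into {1..N} \<pi>' (\<pi> j) else j)"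
  have "bij_betw (inv_into {1..N} \<pi>' \<circ> \<pi>) {1..N} {1..N}"
    using assms bij_betw_inv_into bij_betw_trans by blast
  then have "bij_betw s {1..N} {1..N}"
    by (subst bij_betw_cong[where g = "inv_into {1..N} \<pi>' \<circ> \<pi>"]) (auto simp: s_def)
  then have s: "s permutes {1..N}"
    by (intro bij_imp_permutes) (auto simp: s_def)
  have eq: "\<pi> j = \<pi>' (s j)" if "j \<in> {1..N}" for j
  proof -
    have "\<pi> j \<in> \<pi>' ` {1..N}"
      using assms that unfolding bij_betw_def by blast
    then show ?thesis
      using that by (simp add: s_def f_inv_into_f)
  qed
  have "det_on {1..N} (\<lambda>i j. \<psi> i (\<pi> j ! 0)) = of_int (sign s) * det_on {1..N} (\<lambda>i j. \<psi> i (\<pi>' j ! 0))"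
    unfolding det_on_permute_columns[OF s finite_atLeastAtMost, symmetric]
    by (rule det_on_cong) (simp add: eq)
  moreover have "det_on {1..N} (\<lambda>i j. \<phi> i (\<pi> j ! T)) = of_int (sign s) * det_on {1..N} (\<lambda>i j. \<phi> i (\<pi>' j ! T))"
    unfolding det_on_permute_columns[OF s finite_atLeastAtMost, symmetric]
    by (rule det_on_cong) (simp add: eq)
  moreover have "(\<Prod>i=1..N. path_weight T w (\<pi> i)) = (\<Prod>i=1..N. path_weight T w (\<pi>' i))"
    using prod.permute[OF s, of "\<lambda>i. path_weight T w (\<pi>' i)"] by (simp add: eq)
  moreover have "(of_int (sign s) :: real) * of_int (sign s) = 1"
    by (simp flip: of_int_mult)
  ultimately show ?thesis
    by (simp add: labelled_Wt_def algebra_simps)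
qed

lemma Wt_eq_labelled_Wt:
  assumes "bij_betw \<pi> {1..N} \<P>"
  shows "Wt T N w \<psi> \<phi> \<P> = labelled_Wt T N w \<psi> \<phi> \<pi>"
  unfolding Wt_def
  by (rule labelled_Wt_indep[OF someI[of "\<lambda>\<pi>. bij_betw \<pi> {1..N} \<P>", OF assms] assms])

definition partition_function ::
    "'v pair_pre_digraph \<Rightarrow> nat \<Rightarrow> (nat \<Rightarrow> 'v set) \<Rightarrow> nat \<Rightarrow> ('v \<times> 'v \<Rightarrow> real)
      \<Rightarrow> (nat \<Rightarrow> 'v \<Rightarrow> real) \<Rightarrow> (nat \<Rightarrow> 'v \<Rightarrow> real) \<Rightarrow> real" where
  "partition_function G T V N w \<psi> \<phi> = (\<Sum>\<P>\<in>nonintersecting G T V N. Wt T N w \<psi> \<phi> \<P>)"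

definition path_measure ::
    "'v pair_pre_digraph \<Rightarrow> nat \<Rightarrow> (nat \<Rightarrow> 'v set) \<Rightarrow> nat \<Rightarrow> ('v \<times> 'v \<Rightarrow> real)
      \<Rightarrow> (nat \<Rightarrow> 'v \<Rightarrow> real) \<Rightarrow> (nat \<Rightarrow> 'v \<Rightarrow> real) \<Rightarrow> 'v list set \<Rightarrow> real" where
  "path_measure G T V N w \<psi> \<phi> \<P> = Wt T N w \<psi> \<phi> \<P> / partition_function G T V N w \<psi> \<phi>"

subsection \<open>Operators between function spaces on finite sets\<close>

text \<open>Functions on a set \<open>A\<close> are represented by total functions whose values outside \<open>A\<close> are ignored.\<close>

definition apply_kernel :: "'b set \<Rightarrow> ('a \<Rightarrow> 'b \<Rightarrow> real) \<Rightarrow> ('b \<Rightarrow> real) \<Rightarrow> 'a \<Rightarrow> real" where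
  "apply_kernel B M g x = (\<Sum>y\<in>B. M x y * g y)"

text \<open>
  For \<open>u\<^sub>1, \<dots>, u\<^sub>N\<close> linearly independent on \<open>A\<close>, the linear map on their span that sends \<open>u\<^sub>i\<close> to \<open>v\<^sub>i\<close>.
\<close>

definition span_map ::
    "'a set \<Rightarrow> nat \<Rightarrow> (nat \<Rightarrow> 'a \<Rightarrow> real) \<Rightarrow> (nat \<Rightarrow> 'b \<Rightarrow> real) \<Rightarrow> ('a \<Rightarrow> real) \<Rightarrow> 'b \<Rightarrow> real" where
  "span_map A N u v g y =
     (let c = (SOME c. \<forall>x\<in>A. g x = (\<Sum>i=1..N. c i * u i x)) in \<Sum>i=1..N. c i * v i y)"

lemma span_map_sum:
  assumes biorth: "\<And>i j. i \<in> {1..N} \<Longrightarrow> j \<in> {1..N} \<Longrightarrow>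
      (\<Sum>x\<in>A. \<psi> i x * u j x) = (if i = j then 1 else 0)"
    and g: "\<And>x. x \<in> A \<Longrightarrow> g x = (\<Sum>i=1..N. c i * u i x)"
  shows "span_map A N u v g y = (\<Sum>i=1..N. c i * v i y)"
proof -
  have coeff: "(\<Sum>x\<in>A. \<psi> i x * g x) = d i"
    if d: "\<forall>x\<in>A. g x = (\<Sum>i=1..N. d i * u i x)" and i: "i \<in> {1..N}" for d i
  proof -
    have "(\<Sum>x\<in>A. \<psi> i x * g x) = (\<Sum>x\<in>A. \<Sum>j=1..N. d j * (\<psi> i x * u j x))"
      using d by (intro sum.cong refl) (auto simp: sum_distrib_left algebra_simps)
    also have "\<dots> = (\<Sum>j=1..N. d j * (\<Sum>x\<in>A. \<psi> i x * u j x))"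
      by (subst sum.swap) (simp add: sum_distrib_left)
    also have "\<dots> = (\<Sum>j=1..N. if i = j then d j else 0)"
      using i by (intro sum.cong refl) (auto simp: biorth)
    also have "\<dots> = d i"
      using i by simp
    finally show ?thesis .
  qed
  define d where "d = (SOME c. \<forall>x\<in>A. g x = (\<Sum>i=1..N. c i * u i x))"
  have d: "\<forall>x\<in>A. g x = (\<Sum>i=1..N. d i * u i x)"
    unfolding d_def using g by (intro someI[of "\<lambda>c. \<forall>x\<in>A. g x = (\<Sum>i=1..N. c i * u i x)" c]) auto
  have "d i = c i" if "i \<in> {1..N}" for i
    using coeff[OF d that] coeff[of c, OF _ that] g by simp
  then show ?thesis
    unfolding span_map_def Let_def d_def[symmetric] by (intro sum.cong) auto
qed

text \<open>
  The kernel of the operator obtained by applying \<open>F\<close> after the operator with kernel \<open>M\<close>: its column at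
  \<open>x\<close> is the image under \<open>F\<close> of the corresponding column of \<open>M\<close>.
\<close>

definition compose_kernel ::
    "(('a \<Rightarrow> real) \<Rightarrow> 'b \<Rightarrow> real) \<Rightarrow> ('a \<Rightarrow> 'c \<Rightarrow> real) \<Rightarrow> 'b \<Rightarrow> 'c \<Rightarrow> real" where
  "compose_kernel F M y x = F (\<lambda>x'. M x' x) y"

end

theory Submission
  imports Defs "Jordan_Normal_Form.Determinant"
begin

text \<open>
  In the sum of the weights over all labelled \<open>N\<close>-tuples of paths, the tuples with a common vertex
  cancel: exchanging the tails of two paths after the first collision keeps the edge weights and the
  starting points but changes the sign of \<open>det[\<phi>\<^sub>i(\<pi>\<^sub>j(T))]\<close>.
  Andreief's identity turns the sum over all tuples into \<open>N! det[\<langle>\<psi>\<^sub>i, \<W> \<phi>\<^sub>j\<rangle>]\<close>. For the weights \<open>w\<close> biorthogonality makes this \<open>N!\<close>,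
  so \<open>Z = 1\<close>; for the weights \<open>f w\<close> it gives \<open>det[\<langle>\<psi>\<^sub>i, \<W>' \<phi>\<^sub>j\<rangle>]\<close>, which is the Fredholm
  determinant of the finite rank perturbation \<open>I + \<Sum>\<^sub>i (\<W>' \<phi>\<^sub>i - \<W> \<phi>\<^sub>i) \<otimes> \<psi>\<^sub>i\<close> by
  \<open>det (1 + A B) = det (1 + B A)\<close>.
\<close>

subsection \<open>Determinants over a finite index set\<close>

text \<open>Conjugation by \<open>h\<close> matches the permutations of \<open>A\<close> and
  \<open>B\<close> and keeps signs. This carries operators on an arbitrary finite set over to
  matrices indexed by \<open>{0..<n}\<close>.\<close>

lemma det_on_reindex:
  assumes h: "bij_betw h A B" and fin: "finite A"
  shows "det_on B M = det_on A (\<lambda>i j. M (h i) (h j))"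
proof -
  let ?m = "map_permutation A h"
  have inj: "inj_on h A" and img: "h ` A = B"
    using h by (auto simp: bij_betw_def)
  have bij: "bij_betw ?m {p. p permutes A} {p. p permutes B}"
    using bij_betw_permutations[OF h]
    by (simp add: map_permutation_def[abs_def] img restrict_id_def[abs_def] o_def)
  have "det_on B M = (\<Sum>p | p permutes A. of_int (sign (?m p)) * (\<Prod>i\<in>B. M i (?m p i)))"
    unfolding det_on_def by (rule sum.reindex_bij_betw[OF bij, symmetric])
  also have "\<dots> = (\<Sum>p | p permutes A. of_int (sign p) * (\<Prod>i\<in>A. M (h i) (h (p i))))"
  proof (rule sum.cong[OF refl])
    fix p assume "p \<in> {p. p permutes A}"
    then have p: "p permutes A" by simp
    have "(\<Prod>i\<in>B. M i (?m p i)) = (\<Prod>i\<in>A. M (h i) (?m p (h i)))"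
      by (rule prod.reindex_bij_betw[OF h, symmetric])
    also have "\<dots> = (\<Prod>i\<in>A. M (h i) (h (p i)))"
      by (intro prod.cong refl) (simp add: map_permutation_apply[OF inj])
    finally show "of_int (sign (?m p)) * (\<Prod>i\<in>B. M i (?m p i))
        = of_int (sign p) * (\<Prod>i\<in>A. M (h i) (h (p i)))"
      by (simp add: sign_map_permutation[OF inj p fin])
  qed
  finally show ?thesis by (simp add: det_on_def)
qed

lemma det_on_transpose:
  assumes fin: "finite S"
  shows "det_on S (\<lambda>i j. M j i) = det_on S M"
proof -
  have "det_on S (\<lambda>i j. M j i)
      = (\<Sum>p | p permutes S. of_int (sign (Hilbert_Choice.inv p)) * (\<Prod>i\<in>S. M (Hilbert_Choice.inv p i) i))"
    unfolding det_on_def by (rule sum_permutations_inverse)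
  also have "\<dots> = det_on S M"
    unfolding det_on_def
  proof (rule sum.cong[OF refl])
    fix p assume "p \<in> {p. p permutes S}"
    then have p: "p permutes S" by simp
    have "(\<Prod>i\<in>S. M (Hilbert_Choice.inv p i) i) = (\<Prod>i\<in>S. M (Hilbert_Choice.inv p (p i)) (p i))"
      using prod.permute[OF p, of "\<lambda>i. M (Hilbert_Choice.inv p i) i"] by (simp add: o_def)
    then show "of_int (sign (Hilbert_Choice.inv p)) * (\<Prod>i\<in>S. M (Hilbert_Choice.inv p i) i) = of_int (sign p) * (\<Prod>i\<in>S. M i (p i))"
      using p fin by (simp add: permutes_inverses sign_inverse permutes_imp_permutation)
  qed
  finally show ?thesis .
qed

lemma det_on_scale_columns:
  "det_on S (\<lambda>i j. c j * M i j) = (\<Prod>i\<in>S. c i) * det_on S M"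
proof -
  have "(\<Prod>i\<in>S. c (p i)) = (\<Prod>i\<in>S. c i)" if "p permutes S" for p
    using prod.permute[OF that, of c] by (simp add: o_def)
  then show ?thesis
    by (simp add: det_on_def sum_distrib_left prod.distrib mult_ac)
qed

lemma det_on_eq_det:
  "det_on {0..<n} M = Determinant.det (mat n n (\<lambda>(i, j). M i j))"
proof -
  have "(\<Prod>i = 0..<n. mat n n (\<lambda>(i, j). M i j) $$ (i, p i)) = (\<Prod>i = 0..<n. M i (p i))"
    if "p permutes {0..<n}" for p
    using permutes_in_image[OF that] by (intro prod.cong) auto
  then show ?thesis
    by (simp add: det_on_def Determinant.det_def)
qed

section \<open>Determinants of finite rank perturbations of the identity\<close>

text \<open>With \<open>X = [[1, -A], [B, 1]]\<close> and \<open>Y = [[1, A], [0, 1]]\<close>, both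
  \<open>X * Y\<close> and \<open>Y * X\<close> are block lower triangular. Their diagonal blocks
  are \<open>1, 1 + B * A\<close> and \<open>1 + A * B, 1\<close>, and the two products have the
  same determinant.\<close>

lemma det_one_plus_mult_commute:
  fixes A B :: "'a :: idom mat"
  assumes A: "A \<in> carrier_mat n m" and B: "B \<in> carrier_mat m n"
  shows "Determinant.det (1\<^sub>m n + A * B) = Determinant.det (1\<^sub>m m + B * A)"
proof -
  define X where "X = four_block_mat (1\<^sub>m n) (- A) B (1\<^sub>m m)"
  define Y where "Y = four_block_mat (1\<^sub>m n) A (0\<^sub>m m n) (1\<^sub>m m)"
  have X: "X \<in> carrier_mat (n + m) (n + m)" and Y: "Y \<in> carrier_mat (n + m) (n + m)"
    using A B by (auto simp: X_def Y_def)
  have nA: "- A \<in> carrier_mat n m"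
    using A by simp
  have "X * Y = four_block_mat (1\<^sub>m n * 1\<^sub>m n + - A * 0\<^sub>m m n) (1\<^sub>m n * A + - A * 1\<^sub>m m)
      (B * 1\<^sub>m n + 1\<^sub>m m * 0\<^sub>m m n) (B * A + 1\<^sub>m m * 1\<^sub>m m)"
    unfolding X_def Y_def by (rule mult_four_block_mat) (use A B in auto)
  also have "\<dots> = four_block_mat (1\<^sub>m n) (0\<^sub>m n m) B (1\<^sub>m m + B * A)"
    using A B nA by (intro cong_four_block_mat) (auto intro!: eq_matI)
  finally have XY: "Determinant.det (X * Y) = Determinant.det (1\<^sub>m m + B * A)"
    using A B by (simp add: det_four_block_mat_upper_right_zero[of _ n _ m])
  have "Y * X = four_block_mat (1\<^sub>m n * 1\<^sub>m n + A * B) (1\<^sub>m n * (- A) + A * 1\<^sub>m m)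
      (0\<^sub>m m n * 1\<^sub>m n + 1\<^sub>m m * B) (0\<^sub>m m n * (- A) + 1\<^sub>m m * 1\<^sub>m m)"
    unfolding X_def Y_def by (rule mult_four_block_mat) (use A B in auto)
  also have "\<dots> = four_block_mat (1\<^sub>m n + A * B) (0\<^sub>m n m) B (1\<^sub>m m)"
    using A B nA by (intro cong_four_block_mat) (auto intro!: eq_matI)
  finally have "Determinant.det (Y * X) = Determinant.det (1\<^sub>m n + A * B)"
    using A B by (simp add: det_four_block_mat_upper_right_zero[of _ n _ m])
  with XY show ?thesis
    using det_mult[OF X Y] det_mult[OF Y X] by (simp add: mult.commute)
qed

text \<open>After enumerating \<open>S\<close> and \<open>I\<close>, let \<open>A\<close> have the
  \<open>a i\<close> as columns and \<open>B\<close> the \<open>b i\<close> as rows. The two sides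
  are then \<open>det (1 + A * B)\<close> and \<open>det (1 + B * A)\<close>.\<close>

lemma det_on_finite_rank:
  assumes S: "finite S" and I: "finite I"
  shows "det_on S (\<lambda>x y. (if x = y then 1 else 0) + (\<Sum>i\<in>I. a i x * b i y))
       = det_on I (\<lambda>i j. (if i = j then 1 else 0) + (\<Sum>x\<in>S. b i x * a j x))"
proof -
  define n where "n = card S"
  define m where "m = card I"
  obtain g h where g: "bij_betw g {0..<n} S" and h: "bij_betw h {0..<m} I"
    using ex_bij_betw_nat_finite[OF S] ex_bij_betw_nat_finite[OF I] by (auto simp: n_def m_def)
  define A where "A = mat n m (\<lambda>(x, i). a (h i) (g x))"
  define B where "B = mat m n (\<lambda>(i, x). b (h i) (g x))"
  have eqI: "1\<^sub>m n + A * B = mat n n (\<lambda>(x, y). (if g x = g y then 1 else 0) + (\<Sum>i\<in>I. a i (g x) * b i (g y)))"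
  proof (rule eq_matI)
    fix x y
    assume "x < dim_row (mat n n (\<lambda>(x, y). (if g x = g y then 1 else 0) + (\<Sum>i\<in>I. a i (g x) * b i (g y))))"
      and "y < dim_col (mat n n (\<lambda>(x, y). (if g x = g y then 1 else 0) + (\<Sum>i\<in>I. a i (g x) * b i (g y))))"
    then have xy: "x < n" "y < n" by auto
    have "g x = g y \<longleftrightarrow> x = y"
      using g xy by (auto simp: bij_betw_def inj_on_def)
    moreover have "(\<Sum>i\<in>I. a i (g x) * b i (g y)) = (\<Sum>i = 0..<m. a (h i) (g x) * b (h i) (g y))"
      by (rule sum.reindex_bij_betw[OF h, symmetric])
    ultimately show "(1\<^sub>m n + A * B) $$ (x, y)
        = mat n n (\<lambda>(x, y). (if g x = g y then 1 else 0) + (\<Sum>i\<in>I. a i (g x) * b i (g y))) $$ (x, y)"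
      using xy by (simp add: A_def B_def scalar_prod_def)
  qed (auto simp: A_def B_def)
  have eqS: "1\<^sub>m m + B * A = mat m m (\<lambda>(i, j). (if h i = h j then 1 else 0) + (\<Sum>x\<in>S. b (h i) x * a (h j) x))"
  proof (rule eq_matI)
    fix i j
    assume "i < dim_row (mat m m (\<lambda>(i, j). (if h i = h j then 1 else 0) + (\<Sum>x\<in>S. b (h i) x * a (h j) x)))"
      and "j < dim_col (mat m m (\<lambda>(i, j). (if h i = h j then 1 else 0) + (\<Sum>x\<in>S. b (h i) x * a (h j) x)))"
    then have ij: "i < m" "j < m" by auto
    have "h i = h j \<longleftrightarrow> i = j"
      using h ij by (auto simp: bij_betw_def inj_on_def)
    moreover have "(\<Sum>x\<in>S. b (h i) x * a (h j) x) = (\<Sum>x = 0..<n. b (h i) (g x) * a (h j) (g x))"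
      by (rule sum.reindex_bij_betw[OF g, symmetric])
    ultimately show "(1\<^sub>m m + B * A) $$ (i, j)
        = mat m m (\<lambda>(i, j). (if h i = h j then 1 else 0) + (\<Sum>x\<in>S. b (h i) x * a (h j) x)) $$ (i, j)"
      using ij by (simp add: A_def B_def scalar_prod_def)
  qed (auto simp: A_def B_def)
  have "Determinant.det (1\<^sub>m n + A * B) = Determinant.det (1\<^sub>m m + B * A)"
    by (rule det_one_plus_mult_commute) (auto simp: A_def B_def)
  then show ?thesis
    by (simp add: det_on_reindex[OF g] det_on_reindex[OF h] det_on_eq_det eqI eqS)
qed

lemma det_on_identity:
  assumes "finite S"
  shows "det_on S (\<lambda>i j. if i = j then 1 else 0) = 1"
proof -
  \<comment> \<open>A perturbation of rank zero: the small determinant is over the empty set, where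
    the only permutation contributes an empty product.\<close>
  have "det_on S (\<lambda>i j. if i = j then 1 else 0)
      = det_on ({} :: nat set) (\<lambda>i j. (if i = j then 1 else 0) + (\<Sum>x\<in>S. 0 * 0))"
    using det_on_finite_rank[OF assms, of "{} :: nat set" "\<lambda>_ _. 0" "\<lambda>_ _. 0"] by simp
  also have "\<dots> = 1"
    by (simp add: det_on_def)
  finally show ?thesis .
qed

section \<open>Andreief's identity\<close>

text \<open>A form of Cauchy-Binet that sums over all maps \<open>I \<rightarrow> P\<close>, hence
  the factorial. Each permutation in the expansion of the first determinant contributes the same
  amount, because it can be absorbed by relabelling \<tau>. What remains is a sum of products that
  factorizes over \<open>I\<close>.\<close>

lemma andreief:
  assumes I: "finite I" and P: "finite P"
  shows "(\<Sum>\<tau>\<in>I \<rightarrow>\<^sub>E P. det_on I (\<lambda>i j. a i (\<tau> j)) * det_on I (\<lambda>i j. b i (\<tau> j)))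
       = fact (card I) * det_on I (\<lambda>i j. \<Sum>p\<in>P. a i p * b j p)"
proof -
  define D where "D \<tau> = det_on I (\<lambda>i j. b i (\<tau> j))" for \<tau>
  define g where "g \<tau> = (\<Prod>i\<in>I. a i (\<tau> i)) * D \<tau>" for \<tau>
  have D_comp: "D (\<tau> \<circ> s) = of_int (sign s) * D \<tau>" if "s permutes I" for \<tau> s
    using det_on_permute_columns[OF that I, of "\<lambda>i j. b i (\<tau> j)"] by (simp add: D_def)
  have bij: "bij_betw (\<lambda>\<tau>. \<tau> \<circ> s) (I \<rightarrow>\<^sub>E P) (I \<rightarrow>\<^sub>E P)" if s: "s permutes I" for s
  proof (rule bij_betw_byWitness[where f' = "\<lambda>\<tau>. \<tau> \<circ> Hilbert_Choice.inv s"])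
    \<comment> \<open>A permutation of \<open>I\<close> fixes every point outside \<open>I\<close>,
      so the composition stays extensional.\<close>
    have maps: "\<tau> \<circ> r \<in> I \<rightarrow>\<^sub>E P" if "\<tau> \<in> I \<rightarrow>\<^sub>E P" "r permutes I" for \<tau> r
      using that by (auto simp: PiE_iff extensional_def permutes_in_image permutes_not_in)
    show "(\<lambda>\<tau>. \<tau> \<circ> s) ` (I \<rightarrow>\<^sub>E P) \<subseteq> I \<rightarrow>\<^sub>E P" "(\<lambda>\<tau>. \<tau> \<circ> Hilbert_Choice.inv s) ` (I \<rightarrow>\<^sub>E P) \<subseteq> I \<rightarrow>\<^sub>E P"
      using maps s permutes_inv[OF s] by blast+
  qed (auto simp: fun_eq_iff permutes_inverses[OF s])
  \<comment> \<open>The sign of \<open>s\<close> in the Leibniz expansion is exactly the factor that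
    turns \<open>D \<tau>\<close> into \<open>D (\<tau> \<circ> s)\<close>.\<close>
  have "(\<Sum>\<tau>\<in>I \<rightarrow>\<^sub>E P. det_on I (\<lambda>i j. a i (\<tau> j)) * D \<tau>)
      = (\<Sum>\<tau>\<in>I \<rightarrow>\<^sub>E P. \<Sum>s | s permutes I. g (\<tau> \<circ> s))"
    by (intro sum.cong refl) (simp add: g_def D_comp det_on_def sum_distrib_left mult_ac)
  also have "\<dots> = (\<Sum>s | s permutes I. \<Sum>\<tau>\<in>I \<rightarrow>\<^sub>E P. g (\<tau> \<circ> s))"
    by (rule sum.swap)
  also have "\<dots> = (\<Sum>s | s permutes I. \<Sum>\<tau>\<in>I \<rightarrow>\<^sub>E P. g \<tau>)"
    by (rule sum.cong[OF refl]) (simp add: sum.reindex_bij_betw[OF bij])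
  also have "\<dots> = fact (card I) * (\<Sum>\<tau>\<in>I \<rightarrow>\<^sub>E P. g \<tau>)"
    by (simp add: card_permutations[OF refl I])
  \<comment> \<open>Transposing makes the factor at \<open>i\<close> depend on \<tau> through
    \<open>\<tau> i\<close> alone, so that the sum over \<tau> can be exchanged with the product
    over \<open>I\<close>.\<close>
  also have "(\<Sum>\<tau>\<in>I \<rightarrow>\<^sub>E P. g \<tau>)
      = (\<Sum>\<tau>\<in>I \<rightarrow>\<^sub>E P. \<Sum>r | r permutes I. of_int (sign r) * (\<Prod>i\<in>I. a i (\<tau> i) * b (r i) (\<tau> i)))"
    unfolding g_def D_def
    by (subst det_on_transpose[OF I, symmetric])
       (simp add: det_on_def sum_distrib_left prod.distrib mult_ac)
  also have "\<dots> = (\<Sum>r | r permutes I. of_int (sign r) * (\<Sum>\<tau>\<in>I \<rightarrow>\<^sub>E P. \<Prod>i\<in>I. a i (\<tau> i) * b (r i) (\<tau> i)))"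
    by (subst sum.swap) (simp add: sum_distrib_left)
  also have "\<dots> = det_on I (\<lambda>i j. \<Sum>p\<in>P. a i p * b j p)"
    unfolding det_on_def using I P by (simp add: prod_sum_PiE)
  finally show ?thesis
    by (simp add: D_def)
qed

subsection \<open>Cancellation of the intersecting path families\<close>

text \<open>The starting points stay, the endpoints are permuted by a transposition, and at each
  level the edges are at most permuted. Since \<open>heads\<close> and \<open>tails\<close> both
  cover level \<open>m\<close>, they force paths \<open>i\<close> and \<open>j\<close> to meet
  there.\<close>

lemma labelled_Wt_swap_tails:
  assumes ij: "i \<in> {1..N}" "j \<in> {1..N}" "i \<noteq> j" and m: "m \<le> T"
    and heads: "\<And>k n. k \<in> {1..N} \<Longrightarrow> n \<le> m \<Longrightarrow> \<tau>' k ! n = \<tau> k ! n"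
    and tails: "\<And>k n. k \<in> {1..N} \<Longrightarrow> m \<le> n \<Longrightarrow> n \<le> T \<Longrightarrow> \<tau>' k ! n = \<tau> (Transposition.transpose i j k) ! n"
  shows "labelled_Wt T N w \<psi> \<phi> \<tau>' = - labelled_Wt T N w \<psi> \<phi> \<tau>"
proof -
  let ?s = "Transposition.transpose i j"
  have s: "?s permutes {1..N}"
    using ij(1,2) by (rule permutes_swap_id)
  have "det_on {1..N} (\<lambda>i j. \<psi> i (\<tau>' j ! 0)) = det_on {1..N} (\<lambda>i j. \<psi> i (\<tau> j ! 0))"
    by (rule det_on_cong) (simp add: heads)
  moreover have "det_on {1..N} (\<lambda>i j. \<phi> i (\<tau>' j ! T)) = - det_on {1..N} (\<lambda>i j. \<phi> i (\<tau> j ! T))"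
  proof -
    have "det_on {1..N} (\<lambda>i j. \<phi> i (\<tau>' j ! T)) = det_on {1..N} (\<lambda>i j. \<phi> i (\<tau> (?s j) ! T))"
      using m by (intro det_on_cong) (simp add: tails)
    then show ?thesis
      using det_on_permute_columns[OF s finite_atLeastAtMost, of "\<lambda>i j. \<phi> i (\<tau> j ! T)"] ij(3)
      by (simp add: sign_swap_id)
  qed
  moreover have "(\<Prod>k=1..N. path_weight T w (\<tau>' k)) = (\<Prod>k=1..N. path_weight T w (\<tau> k))"
    unfolding path_weight_def
  proof (subst (1 2) prod.swap, rule prod.cong[OF refl])
    fix n assume "n \<in> {..<T}"
    then have n: "n < T" by simp
    show "(\<Prod>k=1..N. w (\<tau>' k ! n, \<tau>' k ! Suc n)) = (\<Prod>k=1..N. w (\<tau> k ! n, \<tau> k ! Suc n))"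
    \<comment> \<open>For \<open>n < m\<close> the edge ends at level \<open>m\<close> or earlier
      and lies in the unchanged heads. Otherwise both its endpoints are in the exchanged
      tails.\<close>
    proof (cases "n < m")
      case True
      then show ?thesis by (intro prod.cong) (simp_all add: heads)
    next
      case False
      then have "(\<Prod>k=1..N. w (\<tau>' k ! n, \<tau>' k ! Suc n))
          = (\<Prod>k=1..N. w (\<tau> (?s k) ! n, \<tau> (?s k) ! Suc n))"
        using n by (intro prod.cong) (simp_all add: tails)
      also have "\<dots> = (\<Prod>k=1..N. w (\<tau> k ! n, \<tau> k ! Suc n))"
        using prod.permute[OF s, of "\<lambda>k. w (\<tau> k ! n, \<tau> k ! Suc n)"] by (simp add: o_def)
      finally show ?thesis .
    qed
  qed
  ultimately show ?thesis
    by (simp add: labelled_Wt_def)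
qed

section \<open>The exchange of tails as a sign-reversing involution\<close>

text \<open>Comparing equal levels is enough, because in the layered graph different layers are
  disjoint.\<close>

definition first_collision :: "'i set \<Rightarrow> ('i \<Rightarrow> 'v list) \<Rightarrow> nat" where
  "first_collision I \<tau> = (LEAST m. \<not> inj_on (\<lambda>k. \<tau> k ! m) I)"

text \<open>The argument \<open>x\<close> records the vertices at one level only, so the choice
  cannot depend on the tails and is repeated when the exchange is applied a second time.\<close>

definition colliding_pair :: "'i set \<Rightarrow> ('i \<Rightarrow> 'v) \<Rightarrow> 'i \<times> 'i" where
  "colliding_pair I x = (SOME (i, j). i \<in> I \<and> j \<in> I \<and> i \<noteq> j \<and> x i = x j)"

text \<open>
  The first collision and the colliding pair depend only on the positions up to that level, which the
  exchange does not alter; this makes the exchange an involution.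
\<close>

definition swap_tails :: "'i set \<Rightarrow> ('i \<Rightarrow> 'v list) \<Rightarrow> 'i \<Rightarrow> 'v list" where
  "swap_tails I \<tau> =
     (let m = first_collision I \<tau>; (i, j) = colliding_pair I (\<lambda>k. \<tau> k ! m)
      in restrict (\<lambda>k. take m (\<tau> k) @ drop m (\<tau> (Transposition.transpose i j k))) I)"

text \<open>Up to and including the first collision of \<tau>, both families are injective at the
  same levels. The assumption \<open>coll\<close> guarantees that this least level really is a
  collision.\<close>

lemma first_collision_cong:
  assumes coll: "\<not> inj_on (\<lambda>k. \<tau> k ! m) I"
    and eq: "\<And>k n. k \<in> I \<Longrightarrow> n \<le> first_collision I \<tau> \<Longrightarrow> \<tau>' k ! n = \<tau> k ! n"
  shows "first_collision I \<tau>' = first_collision I \<tau>"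
proof -
  let ?m = "first_collision I \<tau>"
  have iff: "inj_on (\<lambda>k. \<tau>' k ! n) I \<longleftrightarrow> inj_on (\<lambda>k. \<tau> k ! n) I" if "n \<le> ?m" for n
    using eq that by (intro inj_on_cong) auto
  have m: "\<not> inj_on (\<lambda>k. \<tau> k ! ?m) I"
    unfolding first_collision_def using coll by (rule LeastI)
  have less: "inj_on (\<lambda>k. \<tau> k ! n) I" if "n < ?m" for n
    using that not_less_Least unfolding first_collision_def by blast
  have "(LEAST n. \<not> inj_on (\<lambda>k. \<tau>' k ! n) I) = ?m"
  proof (rule Least_equality)
    show "\<not> inj_on (\<lambda>k. \<tau>' k ! ?m) I"
      using m iff[of ?m] by simp
    show "?m \<le> n" if "\<not> inj_on (\<lambda>k. \<tau>' k ! n) I" for n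
      using that iff[of n] less[of n] by force
  qed
  then show ?thesis
    by (simp add: first_collision_def)
qed

lemma colliding_pair_cong:
  assumes "\<And>k. k \<in> I \<Longrightarrow> x k = y k"
  shows "colliding_pair I x = colliding_pair I y"
proof -
  have "(\<lambda>(i, j). i \<in> I \<and> j \<in> I \<and> i \<noteq> j \<and> x i = x j) = (\<lambda>(i, j). i \<in> I \<and> j \<in> I \<and> i \<noteq> j \<and> y i = y j)"
    using assms by (auto simp: fun_eq_iff)
  then show ?thesis
    by (simp add: colliding_pair_def)
qed

lemma colliding_pair_collides:
  assumes "\<not> inj_on x I" and "colliding_pair I x = (i, j)"
  shows "i \<in> I" "j \<in> I" "i \<noteq> j" "x i = x j"
proof -
  obtain i' j' where "i' \<in> I" "j' \<in> I" "i' \<noteq> j'" "x i' = x j'"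
    using assms(1) by (auto simp: inj_on_def)
  then have "\<exists>p. case p of (i, j) \<Rightarrow> i \<in> I \<and> j \<in> I \<and> i \<noteq> j \<and> x i = x j"
    by auto
  then have "case colliding_pair I x of (i, j) \<Rightarrow> i \<in> I \<and> j \<in> I \<and> i \<noteq> j \<and> x i = x j"
    unfolding colliding_pair_def by (rule someI_ex)
  then show "i \<in> I" "j \<in> I" "i \<noteq> j" "x i = x j"
    using assms(2) by auto
qed

context layered_planar_digraph
begin

definition colliding_families :: "nat \<Rightarrow> (nat \<Rightarrow> 'v list) set" where
  "colliding_families N =
     {\<tau> \<in> {1..N} \<rightarrow>\<^sub>E layered_paths G T V. \<exists>m\<le>T. \<not> inj_on (\<lambda>k. \<tau> k ! m) {1..N}}"

lemma swap_tails_colliding_families: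
  assumes "\<tau> \<in> colliding_families N"
  shows "swap_tails {1..N} \<tau> \<in> colliding_families N" (is ?mem)
    and "swap_tails {1..N} (swap_tails {1..N} \<tau>) = \<tau>" (is ?inv)
    and "labelled_Wt T N w \<psi> \<phi> (swap_tails {1..N} \<tau>) = - labelled_Wt T N w \<psi> \<phi> \<tau>" (is ?neg)
proof -
  note One_nat_def [simp del]
  let ?I = "{1..N}"
  let ?\<tau>' = "swap_tails ?I \<tau>"
  let ?m = "first_collision ?I \<tau>"
  obtain m0 where ext: "\<tau> \<in> ?I \<rightarrow>\<^sub>E layered_paths G T V"
    and m0: "m0 \<le> T" "\<not> inj_on (\<lambda>k. \<tau> k ! m0) ?I"
    using assms by (auto simp: colliding_families_def)
  have m: "\<not> inj_on (\<lambda>k. \<tau> k ! ?m) ?I"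
    unfolding first_collision_def using m0(2) by (rule LeastI)
  have "?m \<le> m0"
    unfolding first_collision_def using m0(2) by (rule Least_le)
  with m0 have mT: "?m \<le> T" by simp
  obtain i j where pair: "colliding_pair ?I (\<lambda>k. \<tau> k ! ?m) = (i, j)"
    by fastforce
  note ij = colliding_pair_collides[OF m pair]
  let ?s = "Transposition.transpose i j"
  have s: "?s k \<in> ?I" if "k \<in> ?I" for k
    using that ij(1,2) by (auto simp: Transposition.transpose_def)
  \<comment> \<open>At the collision level either path may supply the vertex. Hence the glued lists
    are again paths, and \<open>heads\<close> holds at level \<open>?m\<close> itself.\<close>
  have meet: "\<tau> (?s k) ! ?m = \<tau> k ! ?m" for k
    using ij(4) by (auto simp: Transposition.transpose_def)
  have path: "\<tau> k \<in> layered_paths G T V" if "k \<in> ?I" for k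
    using ext that by auto
  have len: "length (\<tau> k) = Suc T" if "k \<in> ?I" for k
    using path[OF that] by (simp add: layered_paths_def)
  have \<tau>': "?\<tau>' k = take ?m (\<tau> k) @ drop ?m (\<tau> (?s k))" if "k \<in> ?I" for k
    using that unfolding swap_tails_def Let_def pair by simp
  have nth: "?\<tau>' k ! n = (if n < ?m then \<tau> k ! n else \<tau> (?s k) ! n)" if "k \<in> ?I" "n \<le> T" for k n
    using that mT len[OF that(1)] len[OF s[OF that(1)]] by (simp add: \<tau>' nth_append)
  have heads: "?\<tau>' k ! n = \<tau> k ! n" if "k \<in> ?I" "n \<le> ?m" for k n
    using that mT meet nth[OF that(1), of n] by (cases "n = ?m") auto
  have tails: "?\<tau>' k ! n = \<tau> (?s k) ! n" if "k \<in> ?I" "?m \<le> n" "n \<le> T" for k n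
    using that nth[OF that(1,3)] by simp
  have len': "length (?\<tau>' k) = Suc T" if "k \<in> ?I" for k
    using mT len[OF that] len[OF s[OF that]] by (simp add: \<tau>'[OF that])
  have path': "?\<tau>' k \<in> layered_paths G T V" if k: "k \<in> ?I" for k
  proof -
    have "?\<tau>' k ! n \<in> V n" if "n \<le> T" for n
      using nth[OF k that] path[OF k] path[OF s[OF k]] that by (simp add: layered_paths_def)
    moreover have "(?\<tau>' k ! n, ?\<tau>' k ! Suc n) \<in> parcs G" if "n < T" for n
    proof (cases "n < ?m")
      case True
      then show ?thesis
        using that path[OF k] by (simp add: heads[OF k] layered_paths_def)
    next
      case False
      then show ?thesis
        using that path[OF s[OF k]] by (simp add: tails[OF k] layered_paths_def)
    qed
    ultimately show ?thesis
      using len'[OF k] by (simp add: layered_paths_def)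
  qed
  have ext': "?\<tau>' \<in> extensional ?I"
    unfolding swap_tails_def Let_def pair by simp
  \<comment> \<open>Paths \<open>i\<close> and \<open>j\<close> still meet at level
    \<open>?m\<close>.\<close>
  have "\<not> inj_on (\<lambda>k. ?\<tau>' k ! ?m) ?I"
  proof
    assume "inj_on (\<lambda>k. ?\<tau>' k ! ?m) ?I"
    then have "i = j"
      by (rule inj_onD) (use ij heads in simp_all)
    with ij(3) show False by simp
  qed
  then show ?mem
    using mT path' ext' by (auto simp: colliding_families_def PiE_iff)
  have m': "first_collision ?I ?\<tau>' = ?m"
    using m heads by (rule first_collision_cong)
  have pair': "colliding_pair ?I (\<lambda>k. ?\<tau>' k ! ?m) = (i, j)"
    unfolding pair[symmetric] by (rule colliding_pair_cong) (simp add: heads)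
  \<comment> \<open>The second exchange uses the same level and the same transposition, and a
    transposition is its own inverse.\<close>
  show ?inv
  proof (rule extensionalityI[of _ ?I])
    show "swap_tails ?I ?\<tau>' \<in> extensional ?I"
      unfolding swap_tails_def[of ?I ?\<tau>'] Let_def m' pair' by simp
    show "\<tau> \<in> extensional ?I"
      using ext by (simp add: PiE_iff)
    fix k assume k: "k \<in> ?I"
    show "swap_tails ?I ?\<tau>' k = \<tau> k"
    proof -
      have "swap_tails ?I ?\<tau>' k = take ?m (?\<tau>' k) @ drop ?m (?\<tau>' (?s k))"
        using k unfolding swap_tails_def[of ?I ?\<tau>'] Let_def m' pair' by simp
      also have "\<dots> = take ?m (\<tau> k) @ drop ?m (\<tau> k)"
        using k s[OF k] mT len[OF k] len[OF s[OF k]] by (simp add: \<tau>')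
      finally show ?thesis by simp
    qed
  qed
  show ?neg
    using ij(1-3) mT heads tails by (rule labelled_Wt_swap_tails)
qed

text \<open>Reindexing along the involution shows that the sum equals its own negative.\<close>

lemma sum_colliding_families:
  "(\<Sum>\<tau>\<in>colliding_families N. labelled_Wt T N w \<psi> \<phi> \<tau>) = 0"
proof -
  have "(\<Sum>\<tau>\<in>colliding_families N. labelled_Wt T N w \<psi> \<phi> \<tau>)
      = (\<Sum>\<tau>\<in>colliding_families N. - labelled_Wt T N w \<psi> \<phi> \<tau>)"
    by (rule sum.reindex_bij_witness[of _ "swap_tails {1..N}" "swap_tails {1..N}"])
       (simp_all add: swap_tails_colliding_families del: One_nat_def)
  then show ?thesis
    by (simp add: sum_negf)
qed

subsection \<open>The partition function as a determinant\<close>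

lemma finite_layer: "n \<le> T \<Longrightarrow> finite (V n)"
  by (rule finite_subset[OF _ finite_verts]) (auto simp: verts_layers)

lemma finite_layered_paths: "finite (layered_paths G T V)"
proof (rule finite_subset)
  show "layered_paths G T V \<subseteq> {p. set p \<subseteq> pverts G \<and> length p = Suc T}"
    by (auto simp: layered_paths_def verts_layers in_set_conv_nth less_Suc_eq_le) blast
  show "finite {p. set p \<subseteq> pverts G \<and> length p = Suc T}"
    by (rule finite_lists_length_eq) simp
qed

text \<open>A vertex determines its layer, so two paths can share it only at the same level.\<close>

lemma disjoint_paths_iff:
  assumes p: "p \<in> layered_paths G T V" and q: "q \<in> layered_paths G T V"
  shows "set p \<inter> set q = {} \<longleftrightarrow> (\<forall>n\<le>T. p ! n \<noteq> q ! n)"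
proof -
  have "p ! n = q ! n" if nm: "n \<le> T" "m \<le> T" "p ! n = q ! m" for n m
  proof -
    have "p ! n \<in> V n" "p ! n \<in> V m"
      using p q nm by (auto simp: layered_paths_def)
    then have "n = m"
      using disjoint_layers nm by (auto simp: disjoint_family_on_def)
    with nm show ?thesis by simp
  qed
  moreover have "set r = (!) r ` {..T}" if "r \<in> layered_paths G T V" for r
    using that by (auto simp: layered_paths_def set_conv_nth less_Suc_eq_le)
  then have "set p \<inter> set q = {} \<longleftrightarrow> (\<forall>n\<le>T. \<forall>m\<le>T. p ! n \<noteq> q ! m)"
    using p q by auto
  ultimately show ?thesis by metis
qed

lemma noncolliding_iff:
  assumes \<tau>: "\<tau> \<in> {1..N} \<rightarrow>\<^sub>E layered_paths G T V"
  shows "\<tau> \<notin> colliding_families N \<longleftrightarrow> inj_on \<tau> {1..N} \<and> \<tau> ` {1..N} \<in> nonintersecting G T V N"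
proof -
  let ?I = "{1..N}"
  have path: "\<tau> k \<in> layered_paths G T V" if "k \<in> ?I" for k
    using \<tau> that by auto
  have "\<tau> \<notin> colliding_families N \<longleftrightarrow> (\<forall>m\<le>T. \<forall>i\<in>?I. \<forall>j\<in>?I. i \<noteq> j \<longrightarrow> \<tau> i ! m \<noteq> \<tau> j ! m)"
    using \<tau> by (auto simp: colliding_families_def inj_on_def)
  also have "\<dots> \<longleftrightarrow> (\<forall>i\<in>?I. \<forall>j\<in>?I. i \<noteq> j \<longrightarrow> set (\<tau> i) \<inter> set (\<tau> j) = {})"
    using disjoint_paths_iff[OF path path] by blast
  also have "\<dots> \<longleftrightarrow> inj_on \<tau> ?I \<and> pairwise (\<lambda>p q. set p \<inter> set q = {}) (\<tau> ` ?I)"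
  proof -
    \<comment> \<open>A path has \<open>T + 1\<close> vertices, at least one, so equal paths
      intersect; this is why pairwise disjointness makes the labelling injective.\<close>
    have "set (\<tau> i) \<noteq> {}" if "i \<in> ?I" for i
      using path[OF that] by (auto simp: layered_paths_def)
    then have "inj_on \<tau> ?I" if "\<forall>i\<in>?I. \<forall>j\<in>?I. i \<noteq> j \<longrightarrow> set (\<tau> i) \<inter> set (\<tau> j) = {}"
      using that by (metis inf.idem inj_onI)
    moreover have "pairwise (\<lambda>p q. set p \<inter> set q = {}) (\<tau> ` ?I)
        \<longleftrightarrow> (\<forall>i\<in>?I. \<forall>j\<in>?I. i \<noteq> j \<longrightarrow> set (\<tau> i) \<inter> set (\<tau> j) = {})" if "inj_on \<tau> ?I"
      unfolding pairwise_def ball_simps(9)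
      by (intro ball_cong refl) (simp add: inj_on_eq_iff[OF that] del: One_nat_def)
    ultimately show ?thesis by blast
  qed
  also have "\<dots> \<longleftrightarrow> inj_on \<tau> ?I \<and> \<tau> ` ?I \<in> nonintersecting G T V N"
    using path by (auto simp: nonintersecting_def card_image)
  finally show ?thesis .
qed

text \<open>The colliding families cancel, and each non-intersecting collection arises from
  \<open>N!\<close> labellings of equal weight.\<close>

lemma partition_function_eq_sum_families:
  "(\<Sum>\<tau>\<in>{1..N} \<rightarrow>\<^sub>E layered_paths G T V. labelled_Wt T N w \<psi> \<phi> \<tau>)
   = fact N * partition_function G T V N w \<psi> \<phi>"
proof -
  let ?I = "{1..N}"
  let ?L = "layered_paths G T V"
  let ?NC = "(?I \<rightarrow>\<^sub>E ?L) - colliding_families N"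
  have fin: "finite (?I \<rightarrow>\<^sub>E ?L)"
    by (simp add: finite_PiE finite_layered_paths)
  have finNI: "finite (nonintersecting G T V N)"
    by (rule finite_subset[of _ "Pow ?L"]) (auto simp: nonintersecting_def finite_layered_paths)
  \<comment> \<open>The labellings of a collection are the injections into it: being of size
    \<open>N\<close>, it is exhausted by any of them.\<close>
  have fibre: "{\<tau> \<in> ?NC. \<tau> ` ?I = \<P>} = {\<tau> \<in> ?I \<rightarrow>\<^sub>E \<P>. inj_on \<tau> ?I}"
    if \<P>: "\<P> \<in> nonintersecting G T V N" for \<P>
  proof -
    have sub: "\<P> \<subseteq> ?L" and fin\<P>: "finite \<P>" and card\<P>: "card \<P> = N"
      using \<P> by (auto simp: nonintersecting_def)
    have img: "\<tau> ` ?I = \<P>" if "\<tau> \<in> ?I \<rightarrow>\<^sub>E \<P>" "inj_on \<tau> ?I" for \<tau>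
      using that fin\<P> card\<P> by (intro card_subset_eq) (auto simp: card_image)
    show ?thesis
    proof (rule equalityI; rule subsetI)
      fix \<tau> assume \<tau>: "\<tau> \<in> {\<tau> \<in> ?NC. \<tau> ` ?I = \<P>}"
      then have "\<tau> \<in> ?I \<rightarrow>\<^sub>E \<P>"
        by (auto simp: PiE_iff)
      with \<tau> show "\<tau> \<in> {\<tau> \<in> ?I \<rightarrow>\<^sub>E \<P>. inj_on \<tau> ?I}"
        using noncolliding_iff[of \<tau> N] by blast
    next
      fix \<tau> assume \<tau>: "\<tau> \<in> {\<tau> \<in> ?I \<rightarrow>\<^sub>E \<P>. inj_on \<tau> ?I}"
      then have "\<tau> \<in> ?I \<rightarrow>\<^sub>E ?L"
        using sub by (auto simp: PiE_iff)
      with \<tau> \<P> img[of \<tau>] show "\<tau> \<in> {\<tau> \<in> ?NC. \<tau> ` ?I = \<P>}"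
        using noncolliding_iff[of \<tau> N] by simp
    qed
  qed
  have card_fibre: "card {\<tau> \<in> ?I \<rightarrow>\<^sub>E \<P>. inj_on \<tau> ?I} = fact N"
    if \<P>: "\<P> \<in> nonintersecting G T V N" for \<P>
    using \<P> card_inj_on_subset_funcset[of ?I \<P> ?I]
    by (simp add: nonintersecting_def fact_prod_rev)
  have "(\<Sum>\<tau>\<in>?I \<rightarrow>\<^sub>E ?L. labelled_Wt T N w \<psi> \<phi> \<tau>)
      = (\<Sum>\<tau>\<in>?NC. labelled_Wt T N w \<psi> \<phi> \<tau>) + (\<Sum>\<tau>\<in>colliding_families N. labelled_Wt T N w \<psi> \<phi> \<tau>)"
    using fin by (intro sum.subset_diff) (auto simp: colliding_families_def)
  also have "\<dots> = (\<Sum>\<tau>\<in>?NC. labelled_Wt T N w \<psi> \<phi> \<tau>)"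
    by (simp add: sum_colliding_families)
  also have "\<dots> = (\<Sum>\<P>\<in>nonintersecting G T V N. \<Sum>\<tau>\<in>{\<tau> \<in> ?NC. \<tau> ` ?I = \<P>}. labelled_Wt T N w \<psi> \<phi> \<tau>)"
  proof (rule sum.group[symmetric])
    show "(\<lambda>\<tau>. \<tau> ` ?I) ` ?NC \<subseteq> nonintersecting G T V N"
      by (rule image_subsetI) (use noncolliding_iff in blast)
  qed (use fin finNI in auto)
  also have "\<dots> = (\<Sum>\<P>\<in>nonintersecting G T V N. fact N * Wt T N w \<psi> \<phi> \<P>)"
  proof (rule sum.cong[OF refl])
    fix \<P> assume \<P>: "\<P> \<in> nonintersecting G T V N"
    have "labelled_Wt T N w \<psi> \<phi> \<tau> = Wt T N w \<psi> \<phi> \<P>" if "\<tau> \<in> {\<tau> \<in> ?NC. \<tau> ` ?I = \<P>}" for \<tau>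
      using that noncolliding_iff[of \<tau> N] by (intro Wt_eq_labelled_Wt[symmetric]) (simp add: bij_betw_def)
    then have "(\<Sum>\<tau>\<in>{\<tau> \<in> ?NC. \<tau> ` ?I = \<P>}. labelled_Wt T N w \<psi> \<phi> \<tau>)
        = real (card {\<tau> \<in> ?NC. \<tau> ` ?I = \<P>}) * Wt T N w \<psi> \<phi> \<P>"
      by simp
    also have "\<dots> = fact N * Wt T N w \<psi> \<phi> \<P>"
      by (simp only: fibre[OF \<P>] card_fibre[OF \<P>] of_nat_fact)
    finally show "(\<Sum>\<tau>\<in>{\<tau> \<in> ?NC. \<tau> ` ?I = \<P>}. labelled_Wt T N w \<psi> \<phi> \<tau>) = fact N * Wt T N w \<psi> \<phi> \<P>" .
  qed
  finally show ?thesis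
    by (simp add: partition_function_def sum_distrib_left)
qed

text \<open>Paths are grouped by their pair of endpoints; each group sums to an entry of the path
  kernel.\<close>

lemma sum_layered_paths:
  "(\<Sum>p\<in>layered_paths G T V. a (p ! 0) * (path_weight T w p * b (p ! T)))
   = (\<Sum>x\<in>V 0. a x * apply_kernel (V T) (path_kernel G T V w) b x)"
proof -
  let ?L = "layered_paths G T V"
  let ?t = "\<lambda>p. a (p ! 0) * (path_weight T w p * b (p ! T))"
  have "(\<Sum>p\<in>?L. ?t p) = (\<Sum>z\<in>V 0 \<times> V T. \<Sum>p\<in>{p \<in> ?L. (p ! 0, p ! T) = z}. ?t p)"
    using finite_layered_paths finite_layer
    by (intro sum.group[symmetric]) (auto simp: layered_paths_def)
  also have "\<dots> = (\<Sum>(x, y)\<in>V 0 \<times> V T. a x * (path_kernel G T V w x y * b y))"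
    by (intro sum.cong refl)
       (auto simp: path_kernel_def sum_distrib_left sum_distrib_right intro!: sum.cong)
  also have "\<dots> = (\<Sum>x\<in>V 0. a x * apply_kernel (V T) (path_kernel G T V w) b x)"
    by (simp add: apply_kernel_def sum_distrib_left flip: sum.cartesian_product)
  finally show ?thesis .
qed

text \<open>A Lindstroem-Gessel-Viennot formula with boundary determinants. The path weights become
  column factors of the \<phi> determinant, Andreief's identity is applied with whole paths as
  points, and \<open>N!\<close> cancels.\<close>

lemma partition_function_eq_det:
  "partition_function G T V N w \<psi> \<phi>
   = det_on {1..N} (\<lambda>i j. \<Sum>x\<in>V 0. \<psi> i x * apply_kernel (V T) (path_kernel G T V w) (\<phi> j) x)"
proof -
  let ?L = "layered_paths G T V"
  have "fact N * partition_function G T V N w \<psi> \<phi>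
      = (\<Sum>\<tau>\<in>{1..N} \<rightarrow>\<^sub>E ?L. det_on {1..N} (\<lambda>i j. \<psi> i (\<tau> j ! 0)) *
          det_on {1..N} (\<lambda>i j. path_weight T w (\<tau> j) * \<phi> i (\<tau> j ! T)))"
    unfolding partition_function_eq_sum_families[symmetric]
    by (simp add: labelled_Wt_def det_on_scale_columns mult.assoc)
  also have "\<dots> = fact N * det_on {1..N} (\<lambda>i j. \<Sum>p\<in>?L. \<psi> i (p ! 0) * (path_weight T w p * \<phi> j (p ! T)))"
    by (simp add: andreief[OF _ finite_layered_paths, where a = "\<lambda>i p. \<psi> i (p ! 0)"
          and b = "\<lambda>i p. path_weight T w p * \<phi> i (p ! T)"])
  finally show ?thesis
    by (simp add: sum_layered_paths)
qed

section \<open>Reweighting the edges and the final determinant\<close>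

text \<open>The boundary determinants do not involve edge weights. Along a path every step is an arc
  of the matching layer, which is where \<open>w'\<close> is prescribed.\<close>

lemma Wt_reweight:
  assumes w': "\<forall>n<T. \<forall>e\<in>layer_arcs G V n. w' e = f n e * w e"
    and \<P>: "\<P> \<in> nonintersecting G T V N"
  shows "(\<Prod>p\<in>\<P>. \<Prod>n<T. f n (p ! n, p ! Suc n)) * Wt T N w \<psi> \<phi> \<P> = Wt T N w' \<psi> \<phi> \<P>"
proof -
  have sub: "\<P> \<subseteq> layered_paths G T V" and fin: "finite \<P>" and card: "card \<P> = N"
    using \<P> by (auto simp: nonintersecting_def)
  obtain \<pi> where \<pi>: "bij_betw \<pi> {1..N} \<P>"
    using finite_same_card_bij[of "{1..N}" \<P>] fin card by auto
  have "path_weight T w' p = (\<Prod>n<T. f n (p ! n, p ! Suc n)) * path_weight T w p" if "p \<in> \<P>" for p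
  proof -
    have "(p ! n, p ! Suc n) \<in> layer_arcs G V n" if "n < T" for n
      using \<open>p \<in> \<P>\<close> sub that by (auto simp: layered_paths_def layer_arcs_def)
    then show ?thesis
      using w' by (simp add: path_weight_def flip: prod.distrib)
  qed
  then have "(\<Prod>i=1..N. path_weight T w' (\<pi> i))
      = (\<Prod>i=1..N. \<Prod>n<T. f n (\<pi> i ! n, \<pi> i ! Suc n)) * (\<Prod>i=1..N. path_weight T w (\<pi> i))"
    using bij_betw_apply[OF \<pi>] by (simp flip: prod.distrib)
  moreover have "(\<Prod>i=1..N. \<Prod>n<T. f n (\<pi> i ! n, \<pi> i ! Suc n)) = (\<Prod>p\<in>\<P>. \<Prod>n<T. f n (p ! n, p ! Suc n))"
    by (rule prod.reindex_bij_betw[OF \<pi>])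
  ultimately show ?thesis
    by (simp add: Wt_eq_labelled_Wt[OF \<pi>] labelled_Wt_def)
qed

end

theorem theorem1p3:
  fixes G :: "'v pair_pre_digraph" and T N :: nat and V :: "nat \<Rightarrow> 'v set"
    and w w' :: "'v \<times> 'v \<Rightarrow> real" and \<psi> \<phi> \<phi>0 :: "nat \<Rightarrow> 'v \<Rightarrow> real"
    and f :: "nat \<Rightarrow> 'v \<times> 'v \<Rightarrow> real"
    and W W' K :: "'v \<Rightarrow> 'v \<Rightarrow> real"
    and Winv :: "('v \<Rightarrow> real) \<Rightarrow> 'v \<Rightarrow> real"
  assumes graph: "layered_planar_digraph G T V"
    and N: "N \<ge> 1"
    and W: "W = path_kernel G T V w"
    and \<phi>0: "\<phi>0 = (\<lambda>j. apply_kernel (V T) W (\<phi> j))"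
    and biorthogonal: "\<forall>i\<in>{1..N}. \<forall>j\<in>{1..N}.
          (\<Sum>x\<in>V 0. \<psi> i x * \<phi>0 j x) = (if i = j then 1 else 0)"
    and Z: "partition_function G T V N w \<psi> \<phi> \<noteq> 0"
    and w': "\<forall>n<T. \<forall>e\<in>layer_arcs G V n. w' e = f n e * w e"
    and W': "W' = path_kernel G T V w'"
    and K: "K = (\<lambda>x1 x2. \<Sum>i=1..N. \<phi>0 i x1 * \<psi> i x2)"
    and Winv: "Winv = span_map (V 0) N \<phi>0 \<phi>"
  shows "(\<Sum>\<P>\<in>nonintersecting G T V N.
            (\<Prod>p\<in>\<P>. \<Prod>n<T. f n (p ! n, p ! Suc n)) * path_measure G T V N w \<psi> \<phi> \<P>)
         = det_on (V 0) (\<lambda>x1 x2. (if x1 = x2 then 1 else 0) - K x1 x2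
             + compose_kernel (apply_kernel (V T) W') (compose_kernel Winv K) x1 x2)"
proof -
  interpret layered_planar_digraph G T V by (rule graph)
  \<comment> \<open>Biorthogonality makes the determinant that of the identity, so
    \<open>path_measure\<close> coincides with \<open>Wt\<close>.\<close>
  have Z_eq: "partition_function G T V N w \<psi> \<phi> = 1"
  proof -
    have "partition_function G T V N w \<psi> \<phi> = det_on {1..N} (\<lambda>i j. if i = j then 1 else 0)"
      unfolding partition_function_eq_det
      using biorthogonal unfolding \<phi>0 W by (intro det_on_cong) blast
    then show ?thesis
      by (simp add: det_on_identity)
  qed
  \<comment> \<open>The column of \<open>K\<close> at \<open>x\<close> is the combination of the
    \<open>\<phi>0 i\<close> with coefficients \<open>\<psi> i x\<close>; biorthogonality makes
    these coefficients unique.\<close>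
  have WinvK: "compose_kernel Winv K y x = (\<Sum>i=1..N. \<psi> i x * \<phi> i y)" for x y
    unfolding compose_kernel_def Winv K
    using biorthogonal by (intro span_map_sum[where \<psi> = \<psi>]) (simp_all add: mult.commute)
  have W'WinvK: "compose_kernel (apply_kernel (V T) W') (compose_kernel Winv K) x1 x2
      = (\<Sum>i=1..N. apply_kernel (V T) W' (\<phi> i) x1 * \<psi> i x2)" for x1 x2
    unfolding compose_kernel_def[of "apply_kernel (V T) W'"] apply_kernel_def WinvK
      sum_distrib_left sum_distrib_right
    by (subst sum.swap) (simp add: mult_ac)
  have "(\<Sum>\<P>\<in>nonintersecting G T V N.
            (\<Prod>p\<in>\<P>. \<Prod>n<T. f n (p ! n, p ! Suc n)) * path_measure G T V N w \<psi> \<phi> \<P>)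
      = partition_function G T V N w' \<psi> \<phi>"
    unfolding path_measure_def Z_eq partition_function_def[of _ _ _ _ w']
    using Wt_reweight[OF w'] by (intro sum.cong) simp_all
  also have "\<dots> = det_on {1..N} (\<lambda>i j. \<Sum>x\<in>V 0. \<psi> i x * apply_kernel (V T) W' (\<phi> j) x)"
    by (simp add: partition_function_eq_det W')
  \<comment> \<open>The identity matrix is split off as the biorthogonal pairing of
    \<open>\<psi> i\<close> with \<open>\<phi>0 j\<close>, which gives the form required by
    \<open>det_on_finite_rank\<close>.\<close>
  also have "\<dots> = det_on {1..N} (\<lambda>i j. (if i = j then 1 else 0)
      + (\<Sum>x\<in>V 0. \<psi> i x * (apply_kernel (V T) W' (\<phi> j) x - \<phi>0 j x)))"
    using biorthogonal by (intro det_on_cong) (simp add: right_diff_distrib sum_subtractf)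
  \<comment> \<open>The passage from size \<open>N\<close> to size \<open>card (V 0)\<close>, with
    \<open>a i\<close> the difference of the images of \<open>\<phi> i\<close> under
    \<open>W'\<close> and \<open>W\<close>, and \<open>b i = \<psi> i\<close>.\<close>
  also have "\<dots> = det_on (V 0) (\<lambda>x1 x2. (if x1 = x2 then 1 else 0)
      + (\<Sum>i=1..N. (apply_kernel (V T) W' (\<phi> i) x1 - \<phi>0 i x1) * \<psi> i x2))"
    by (intro det_on_finite_rank[symmetric] finite_layer) simp_all
  also have "\<dots> = det_on (V 0) (\<lambda>x1 x2. (if x1 = x2 then 1 else 0) - K x1 x2
             + compose_kernel (apply_kernel (V T) W') (compose_kernel Winv K) x1 x2)"
    unfolding W'WinvK unfolding K
    by (intro det_on_cong) (simp add: left_diff_distrib sum_subtractf)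
  finally show ?thesis .
qed

end
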